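(* Consider the system in the unknowns $h$, $hu_e$, $\delta_1u_e$ (functions of $(t,x)$): $$\partial_t h+\partial_x(hu_e-\bar\delta\delta_1u_e)=0,$$ $$\partial_t(hu_e)+\partial_x\Big(hu_e^2+\frac{h^2}{2Fr^2}\Big)-u_e\,\partial_x(\bar\delta\delta_1u_e)=0,$$ $$\partial_t(\delta_1u_e)+\partial_x\Big(\big(1+\tfrac1H\big)\delta_1u_e^2\Big)-u_e\,\partial_x(\delta_1u_e)=0,$$ where the shape factor $H$ is given by a closure formula and depends only on $u_e$ and $\delta_1u_e$. Put $$a=\frac{\partial}{\partial u_e}\Big(\big(1+\tfrac1H\big)\delta_1u_e^2\Big),\qquad b=\frac{\partial}{\partial(\delta_1u_e)}\Big(\big(1+\tfrac1H\big)\delta_1u_e^2\Big),$$ the flux $(1+\frac1H)\delta_1u_e^2$ being regarded as a function of the independent variables $u_e$ and $\delta_1u_e$, and $$P_{SW}(\lambda)=(b-u_e-\lambda)\Big((u_e-\lambda)^2-\frac{h}{Fr^2}\Big).$$ Then, for $\bar\delta$ small enough, the characteristic polynomial of the system admits 3 real roots and the system is hyperbolic. More precisely, denoting by $\lambda_-<\lambda_+$ the roots of $P_{SW}'$, the system is hyperbolic when $$P_{SW}(\lambda_-)<\frac{\bar\delta\,a}{Fr^2}<P_{SW}(\lambda_+).$$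
   Context: This is the convective part (without the topography and friction source terms) of an extended shallow water model in its Interactive Boundary Layer form. Here $h>0$ is the water depth, $u_e$ the ideal fluid velocity, $\delta_1$ the displacement thickness of the viscous layer at the bottom, $Fr>0$ the Froude number, $\bar\delta>0$ a small parameter related to the thickness of the viscous layer, and $H$ the shape factor (ratio of the displacement thickness to the momentum thickness of the viscous layer). A system written in quasi-linear form $\partial_tW+A(W)\partial_xW=0$, here with $W=(h,hu_e,\delta_1u_e)^T$, is called hyperbolic if the matrix $A(W)$ is diagonalizable over $\mathbb{R}$. Its eigenvalues are invariant under change of variables, e.g. to $Y=(h,u_e,\delta_1u_e)^T$. The eigenvalues are the solutions $\lambda$ of $P_{SW}(\lambda)=\bar\delta a/Fr^2$, and the three real roots of $P_{SW}$ are $u_e\pm\sqrt{h}/Fr$ and $b-u_e$.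
   Formalization: The claim for small δ̄ assumes that b−u_e differs from u_e±√h/Fr (the three roots of P_SW are distinct); without this it fails, e.g. H=1/2, h=Fr=u_e=1, δ_1>0 gives only one real root for every δ̄>0. *)

theory Defs
  imports "HOL-Analysis.Analysis" "HOL-Computational_Algebra.Polynomial"
begin

definition diagonal_matrix :: "real ^ 'n ^ 'n \<Rightarrow> bool" where
  "diagonal_matrix D \<longleftrightarrow> (\<forall>i j. i \<noteq> j \<longrightarrow> D $ i $ j = 0)"

definition diagonalizable :: "real ^ 'n ^ 'n \<Rightarrow> bool" where
  "diagonalizable A \<longleftrightarrow>
    (\<exists>(P :: real ^ 'n ^ 'n) D. invertible P \<and> diagonal_matrix D \<and> A = P ** D ** matrix_inv P)"

definition charpoly :: "real ^ 'n ^ 'n \<Rightarrow> real poly" where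
  "charpoly A = det (mat [:0, 1:] - map_matrix (\<lambda>c. [:c:]) A)"

text \<open>
  A first-order system for an unknown field \<open>W (t, x)\<close> is a predicate \<open>S\<close>: the proposition \<open>S W t x\<close>
  says that \<open>W\<close> satisfies the equations at the point \<open>(t, x)\<close>. The matrix \<open>A\<close> is the matrix of the
  quasi-linear form of \<open>S\<close> at the state \<open>W0\<close> if, for every field passing through \<open>W0\<close>, the equations
  amount to \<open>W\<^sub>t + A W\<^sub>x = 0\<close>. There is at most one such matrix (see the lemma below).
\<close>

definition quasilinear_matrix_at ::
  "((real \<Rightarrow> real \<Rightarrow> real ^ 'n) \<Rightarrow> real \<Rightarrow> real \<Rightarrow> bool) \<Rightarrow> real ^ 'n \<Rightarrow> real ^ 'n ^ 'n \<Rightarrow> bool" where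
  "quasilinear_matrix_at S W0 A \<longleftrightarrow>
    (\<forall>W t x. W t x = W0 \<longrightarrow>
       (\<lambda>s. W s x) differentiable (at t) \<longrightarrow> (\<lambda>y. W t y) differentiable (at x) \<longrightarrow>
       (S W t x \<longleftrightarrow>
         vector_derivative (\<lambda>s. W s x) (at t) + A *v vector_derivative (\<lambda>y. W t y) (at x) = 0))"

lemma quasilinear_matrix_at_unique:
  assumes A: "quasilinear_matrix_at S W0 A" and B: "quasilinear_matrix_at S W0 B"
  shows "A = B"
proof -
  have "A *v v = B *v v" for v
  proof -
    define W where "W = (\<lambda>t x :: real. W0 + t *\<^sub>R (- (A *v v)) + x *\<^sub>R v)"
    have t: "((\<lambda>s. W s 0) has_vector_derivative - (A *v v)) (at 0)"
      unfolding W_def by (auto intro!: derivative_eq_intros)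
    have x: "((\<lambda>y. W 0 y) has_vector_derivative v) (at 0)"
      unfolding W_def by (auto intro!: derivative_eq_intros)
    have d: "(\<lambda>s. W s 0) differentiable (at 0)" "(\<lambda>y. W 0 y) differentiable (at 0)"
      using t x by (auto intro: differentiableI_vector)
    have W: "W 0 0 = W0"
      by (simp add: W_def)
    have "- (A *v v) + A *v v = 0 \<longleftrightarrow> - (A *v v) + B *v v = 0"
      using A B W d unfolding quasilinear_matrix_at_def
      by (metis vector_derivative_at[OF t] vector_derivative_at[OF x])
    then show ?thesis
      by (simp add: neg_eq_iff_add_eq_0)
  qed
  then show ?thesis
    by (simp add: matrix_eq)
qed

definition hyperbolic_at ::
  "((real \<Rightarrow> real \<Rightarrow> real ^ 'n) \<Rightarrow> real \<Rightarrow> real \<Rightarrow> bool) \<Rightarrow> real ^ 'n \<Rightarrow> bool" where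
  "hyperbolic_at S W0 \<longleftrightarrow> (\<exists>A. quasilinear_matrix_at S W0 A \<and> diagonalizable A)"

text \<open>
  Throughout, \<open>m\<close> stands for the unknown \<open>\<delta>\<^sub>1 u\<^sub>e\<close>, and \<open>H u m\<close> is the closure for the shape factor.
  In terms of the independent variables \<open>u\<^sub>e\<close> and \<open>\<delta>\<^sub>1 u\<^sub>e\<close>, the quantity \<open>\<delta>\<^sub>1 u\<^sub>e\<^sup>2\<close> is \<open>m * u\<close>.
\<close>

definition bl_flux :: "(real \<Rightarrow> real \<Rightarrow> real) \<Rightarrow> real \<Rightarrow> real \<Rightarrow> real" where
  "bl_flux H u m = (1 + 1 / H u m) * (m * u)"

definition coeff_a :: "(real \<Rightarrow> real \<Rightarrow> real) \<Rightarrow> real \<Rightarrow> real \<Rightarrow> real" where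
  "coeff_a H u m = deriv (\<lambda>v. bl_flux H v m) u"

definition coeff_b :: "(real \<Rightarrow> real \<Rightarrow> real) \<Rightarrow> real \<Rightarrow> real \<Rightarrow> real" where
  "coeff_b H u m = deriv (\<lambda>n. bl_flux H u n) m"

text \<open>The components of the field \<open>W\<close> are \<open>h\<close>, \<open>h u\<^sub>e\<close> and \<open>\<delta>\<^sub>1 u\<^sub>e\<close>; \<open>db\<close> is the small parameter.\<close>

definition ibl_system ::
  "(real \<Rightarrow> real \<Rightarrow> real) \<Rightarrow> real \<Rightarrow> real \<Rightarrow> (real \<Rightarrow> real \<Rightarrow> real ^ 3) \<Rightarrow> real \<Rightarrow> real \<Rightarrow> bool" where
  "ibl_system H Fr db W t x \<longleftrightarrow>
    (let h = (\<lambda>t x. W t x $ 1);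
         q = (\<lambda>t x. W t x $ 2);
         m = (\<lambda>t x. W t x $ 3);
         u = (\<lambda>t x. q t x / h t x)
     in deriv (\<lambda>s. h s x) t + deriv (\<lambda>y. q t y - db * m t y) x = 0 \<and>
        deriv (\<lambda>s. q s x) t + deriv (\<lambda>y. h t y * (u t y)\<^sup>2 + (h t y)\<^sup>2 / (2 * Fr\<^sup>2)) x
          - u t x * deriv (\<lambda>y. db * m t y) x = 0 \<and>
        deriv (\<lambda>s. m s x) t + deriv (\<lambda>y. bl_flux H (u t y) (m t y)) x
          - u t x * deriv (\<lambda>y. m t y) x = 0)"

definition P_SW :: "(real \<Rightarrow> real \<Rightarrow> real) \<Rightarrow> real \<Rightarrow> real \<Rightarrow> real \<Rightarrow> real \<Rightarrow> real \<Rightarrow> real" where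
  "P_SW H Fr h u m l = (coeff_b H u m - u - l) * ((u - l)\<^sup>2 - h / Fr\<^sup>2)"

text \<open>
  The characteristic polynomial of \<open>S\<close> at the state \<open>W0\<close>, i.e. of its quasi-linear matrix there,
  has three distinct real roots.
\<close>

definition three_real_roots_at ::
  "((real \<Rightarrow> real \<Rightarrow> real ^ 3) \<Rightarrow> real \<Rightarrow> real \<Rightarrow> bool) \<Rightarrow> real ^ 3 \<Rightarrow> bool" where
  "three_real_roots_at S W0 \<longleftrightarrow>
    (\<exists>A. quasilinear_matrix_at S W0 A \<and> card {l. poly (charpoly A) l = 0} = 3)"

end

theory Submission
  imports Defs "HOL-Real_Asymp.Real_Asymp"
begin

text \<open>
  The characteristic polynomial of the quasi-linear matrix is \<open>db * a / Fr\<^sup>2 - P_SW\<close>. Since the cubic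
  \<open>P_SW\<close> tends to \<open>\<plusminus>\<infinity>\<close> at \<open>\<mp>\<infinity>\<close>, a level \<open>k\<close> is attained exactly three times as soon as
  \<open>P_SW p < k < P_SW q\<close> for some \<open>p < q\<close>. The critical points are such a pair by assumption; for small
  \<open>db\<close>, take one point in each gap between consecutive roots of \<open>P_SW\<close>.
\<close>

section \<open>Distinct real eigenvalues and diagonalizability\<close>

lemma poly_charpoly: "poly (charpoly A) x = det (mat x - A)"
  unfolding charpoly_def det_def
  by (auto simp: poly_sum poly_prod mat_def map_matrix_def of_int_poly intro!: sum.cong prod.cong)

lemma eigenvector_if_charpoly_root:
  assumes "poly (charpoly A) x = 0"
  obtains v where "v \<noteq> 0" "A *v v = x *\<^sub>R v"
proof -
  have "\<not> invertible (mat x - A)"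
    using assms by (simp add: poly_charpoly invertible_det_nz)
  then obtain v where "v \<noteq> 0" "(mat x - A) *v v = 0"
    by (metis invertible_left_inverse matrix_left_invertible_ker)
  moreover have "mat x *v v = x *\<^sub>R v"
    by (simp add: vec_eq_iff matrix_vector_mult_def mat_def if_distrib[of "\<lambda>a. a * _"] cong: if_cong)
  ultimately show ?thesis
    using that by (simp add: matrix_vector_mult_diff_rdistrib)
qed

text \<open>Linear independence in coordinate form, with an indexed family and explicit
  coefficients, so that it applies directly to the kernel of a matrix whose columns are
  eigenvectors.\<close>

lemma eigenvectors_combination_zero:
  fixes A :: "real ^ 'n ^ 'n"
  assumes "finite S" and "inj_on ev S"
    and "\<And>i. i \<in> S \<Longrightarrow> A *v v i = ev i *\<^sub>R v i" and "\<And>i. i \<in> S \<Longrightarrow> v i \<noteq> 0"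
    and "(\<Sum>i\<in>S. c i *\<^sub>R v i) = 0"
  shows "\<forall>i\<in>S. c i = 0"
  using assms
proof (induction S arbitrary: c rule: finite_induct)
  case (insert k S)
  \<comment> \<open>Applying \<open>A - ev k\<close> eliminates \<open>v k\<close> from the combination.\<close>
  have "(\<Sum>i\<in>insert k S. (c i * (ev i - ev k)) *\<^sub>R v i) =
      A *v (\<Sum>i\<in>insert k S. c i *\<^sub>R v i) - ev k *\<^sub>R (\<Sum>i\<in>insert k S. c i *\<^sub>R v i)"
    unfolding linear_sum[OF matrix_vector_mul_linear] scaleR_sum_right sum_subtractf[symmetric]
    using insert.prems(2) by (intro sum.cong) (auto simp: algebra_simps)
  then have "(\<Sum>i\<in>S. (c i * (ev i - ev k)) *\<^sub>R v i) = 0"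
    using insert.prems(4) insert.hyps by simp
  then have "\<forall>i\<in>S. c i * (ev i - ev k) = 0"
    using insert.prems by (intro insert.IH) auto
  moreover have "ev i \<noteq> ev k" if "i \<in> S" for i
    using insert.prems(1) insert.hyps that by (auto simp: inj_on_def)
  ultimately have "\<forall>i\<in>S. c i = 0" by auto
  then show ?case
    using insert.prems(3,4) insert.hyps by auto
qed simp

text \<open>The eigenvectors are the columns of \<open>P\<close>: their independence makes
  \<open>P\<close> invertible, and \<open>A ** P = P ** D\<close> restates the eigenvalue equations
  column by column.\<close>

lemma diagonalizable_if_distinct_eigenvalues:
  fixes A :: "real ^ 'n ^ 'n"
  assumes "card {l. poly (charpoly A) l = 0} = CARD('n)"
  shows "diagonalizable A"
proof -
  \<comment> \<open>An infinite set has \<open>card\<close> 0, whereas \<open>CARD('n)\<close> is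
    positive.\<close>
  have "finite {l. poly (charpoly A) l = 0}"
    using assms by (metis card.infinite zero_less_card_finite less_irrefl)
  \<comment> \<open>Equal cardinalities let the index type itself enumerate the roots, as the
    columns of \<open>P\<close> and the diagonal of \<open>D\<close> require.\<close>
  then obtain ev where "bij_betw ev (UNIV :: 'n set) {l. poly (charpoly A) l = 0}"
    using assms finite_same_card_bij[of "UNIV :: 'n set"] by force
  then have ev: "inj ev" "poly (charpoly A) (ev i) = 0" for i
    by (auto simp: bij_betw_def)
  have "\<exists>v. v \<noteq> 0 \<and> A *v v = ev i *\<^sub>R v" for i
    using eigenvector_if_charpoly_root[OF ev(2)] by metis
  then obtain v where v: "\<And>i. v i \<noteq> 0" "\<And>i. A *v v i = ev i *\<^sub>R v i"
    by metis
  define P :: "real ^ 'n ^ 'n" where "P = (\<chi> r i. v i $ r)"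
  define D :: "real ^ 'n ^ 'n" where "D = (\<chi> r i. if r = i then ev i else 0)"
  have P: "P *v y = (\<Sum>i\<in>UNIV. y $ i *\<^sub>R v i)" for y
    by (simp add: P_def vec_eq_iff matrix_vector_mult_def mult.commute)
  have "y = 0" if "P *v y = 0" for y
  proof -
    have "\<forall>i\<in>UNIV. y $ i = 0"
      using that unfolding P by (intro eigenvectors_combination_zero[OF _ ev(1) v(2,1)]) auto
    then show ?thesis by (simp add: vec_eq_iff)
  qed
  then have inv: "invertible P"
    by (simp add: invertible_left_inverse matrix_left_invertible_ker)
  have "A ** P = P ** D"
  proof -
    have "(A ** P) $ r $ i = (P ** D) $ r $ i" for r i
    proof -
      have "(A ** P) $ r $ i = (A *v v i) $ r"
        by (simp add: P_def matrix_matrix_mult_def matrix_vector_mult_def)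
      also have "\<dots> = (P ** D) $ r $ i"
        by (simp add: v(2) P_def D_def matrix_matrix_mult_def if_distrib[of "\<lambda>a. _ * a"] cong: if_cong)
      finally show ?thesis .
    qed
    then show ?thesis by (simp add: vec_eq_iff)
  qed
  moreover have "P ** matrix_inv P = mat 1"
    using inv unfolding invertible_def matrix_inv_def by (rule someI2_ex) simp
  ultimately have "A = P ** D ** matrix_inv P"
    by (metis matrix_mul_assoc matrix_mul_rid)
  moreover have "diagonal_matrix D"
    by (simp add: diagonal_matrix_def D_def)
  ultimately show ?thesis
    using inv unfolding diagonalizable_def by blast
qed

section \<open>Chain rule and quasi-linear form of the system\<close>

lemma has_vector_derivative_vec_nth:
  assumes "(f has_vector_derivative f') (at x)"
  shows "((\<lambda>x. f x $ i) has_real_derivative f' $ i) (at x)"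
  using bounded_linear.has_vector_derivative[OF bounded_linear_vec_nth assms]
  by (simp add: has_real_derivative_iff_has_vector_derivative)

text \<open>Existence of both partial derivatives alone would not give a chain rule; total
  differentiability does, and the values of the derivative \<open>D\<close> at the two unit vectors
  turn out to be the coefficients.\<close>

lemma bl_flux_chain:
  assumes "(\<lambda>(v, n). bl_flux H v n) differentiable (at (f y, g y))"
    and f: "(f has_real_derivative f') (at y)" and g: "(g has_real_derivative g') (at y)"
  shows "((\<lambda>y. bl_flux H (f y) (g y)) has_real_derivative
           coeff_a H (f y) (g y) * f' + coeff_b H (f y) (g y) * g') (at y)"
proof -
  define F where "F = (\<lambda>(v, n). bl_flux H v n)"
  obtain D where D: "(F has_derivative D) (at (f y, g y))"
    using assms(1) unfolding differentiable_def F_def by blast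
  interpret D: bounded_linear D
    using D by (rule has_derivative_bounded_linear)
  \<comment> \<open>Stated for arbitrary curves through the point and an arbitrary parameter value
    \<open>y0\<close>: the coordinate lines, parametrized by their own coordinate, identify the
    partial derivatives, and \<open>f\<close>, \<open>g\<close> give the claim.\<close>
  have chain: "((\<lambda>y. bl_flux H (p y) (q y)) has_real_derivative p' * D (1, 0) + q' * D (0, 1)) (at y0)"
    if p: "(p has_real_derivative p') (at y0)" and q: "(q has_real_derivative q') (at y0)"
      and "p y0 = f y" "q y0 = g y" for p q p' q' y0
  proof -
    have "((\<lambda>y. (p y, q y)) has_derivative (\<lambda>t. (t * p', t * q'))) (at y0)"
      using p q by (intro has_derivative_Pair) (simp_all add: has_field_derivative_def mult_commute_abs)
    then have "((\<lambda>y. F (p y, q y)) has_derivative (\<lambda>t. D (t * p', t * q'))) (at y0)"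
      by (rule has_derivative_compose) (simp add: that D)
    moreover have "D (t * p', t * q') = (p' * D (1, 0) + q' * D (0, 1)) * t" for t
    proof -
      have "(t * p', t * q') = (t * p') *\<^sub>R (1, 0) + (t * q') *\<^sub>R (0, 1)" by simp
      then have "D (t * p', t * q') = (t * p') *\<^sub>R D (1, 0) + (t * q') *\<^sub>R D (0, 1)"
        by (simp only: D.add D.scaleR)
      then show ?thesis by (simp add: algebra_simps)
    qed
    ultimately show ?thesis
      by (simp add: F_def has_field_derivative_def)
  qed
  have "coeff_a H (f y) (g y) = D (1, 0)"
    unfolding coeff_a_def
    using chain[of "\<lambda>v. v" 1 "f y" "\<lambda>_. g y" 0] by (intro DERIV_imp_deriv) simp
  moreover have "coeff_b H (f y) (g y) = D (0, 1)"
    unfolding coeff_b_def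
    using chain[of "\<lambda>_. f y" 0 "g y" "\<lambda>n. n" 1] by (intro DERIV_imp_deriv) simp
  ultimately show ?thesis
    using chain[OF f g] by (simp add: mult.commute)
qed

text \<open>Each row is one equation with its derivatives expanded. Eliminating the derivative of
  \<open>u\<close> through \<open>u = q / h\<close> produces the divisions by \<open>h\<close> in
  the last row; its entry \<open>coeff_b H u m - u\<close> also absorbs the nonconservative
  term.\<close>

definition ibl_matrix ::
  "(real \<Rightarrow> real \<Rightarrow> real) \<Rightarrow> real \<Rightarrow> real \<Rightarrow> real \<Rightarrow> real \<Rightarrow> real \<Rightarrow> real ^ 3 ^ 3" where
  "ibl_matrix H Fr db h u m = vector
     [vector [0, 1, - db],
      vector [h / Fr\<^sup>2 - u\<^sup>2, 2 * u, - db * u],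
      vector [- coeff_a H u m * u / h, coeff_a H u m / h, coeff_b H u m - u]]"

lemma quasilinear_matrix_ibl_system:
  assumes "Fr > 0" and "h > 0"
    and diff: "(\<lambda>(v, n). bl_flux H v n) differentiable (at (u, m))"
  shows "quasilinear_matrix_at (ibl_system H Fr db) (vector [h, h * u, m]) (ibl_matrix H Fr db h u m)"
  unfolding quasilinear_matrix_at_def
proof (intro allI impI)
  fix W :: "real \<Rightarrow> real \<Rightarrow> real ^ 3" and t x
  assume W: "W t x = vector [h, h * u, m]"
    and "(\<lambda>s. W s x) differentiable (at t)" "(\<lambda>y. W t y) differentiable (at x)"
  define Wt where "Wt = vector_derivative (\<lambda>s. W s x) (at t)"
  define Wx where "Wx = vector_derivative (\<lambda>y. W t y) (at x)"
  have dt: "((\<lambda>s. W s x $ i) has_real_derivative Wt $ i) (at t)" for i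
    using \<open>(\<lambda>s. W s x) differentiable (at t)\<close> unfolding Wt_def
    by (intro has_vector_derivative_vec_nth) (simp add: vector_derivative_works)
  have dx: "((\<lambda>y. W t y $ i) has_real_derivative Wx $ i) (at x)" for i
    using \<open>(\<lambda>y. W t y) differentiable (at x)\<close> unfolding Wx_def
    by (intro has_vector_derivative_vec_nth) (simp add: vector_derivative_works)
  have W123: "W t x $ 1 = h" "W t x $ 2 = h * u" "W t x $ 3 = m"
    by (simp_all add: W)
  note nz = \<open>h > 0\<close> \<open>Fr > 0\<close>
  \<comment> \<open>The quotient rule for \<open>q / h\<close> at a point where
    \<open>q = h * u\<close>.\<close>
  define ux where "ux = (Wx $ 2 - u * Wx $ 1) / h"
  have u: "((\<lambda>y. W t y $ 2 / W t y $ 1) has_real_derivative ux) (at x)"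
    using nz by (auto intro!: derivative_eq_intros dx simp: W123 ux_def field_simps)
  have 1: "deriv (\<lambda>y. W t y $ 2 - db * W t y $ 3) x = Wx $ 2 - db * Wx $ 3"
    by (rule DERIV_imp_deriv) (auto intro!: derivative_eq_intros dx)
  have 2: "deriv (\<lambda>y. W t y $ 1 * (W t y $ 2 / W t y $ 1)\<^sup>2 + (W t y $ 1)\<^sup>2 / (2 * Fr\<^sup>2)) x =
      (h / Fr\<^sup>2 - u\<^sup>2) * Wx $ 1 + 2 * u * Wx $ 2"
  proof (rule DERIV_imp_deriv)
    have "((\<lambda>y. W t y $ 1 * (W t y $ 2 / W t y $ 1)\<^sup>2 + (W t y $ 1)\<^sup>2 / (2 * Fr\<^sup>2)) has_real_derivative
        (Wx $ 1 * u\<^sup>2 + 2 * ux * u * h) + 2 * Wx $ 1 * h / (2 * Fr\<^sup>2)) (at x)"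
      using DERIV_add[OF DERIV_mult[OF dx[of 1] DERIV_power[OF u, where n = 2]]
          DERIV_cdivide[OF DERIV_power[OF dx[of 1], where n = 2], where c = "2 * Fr\<^sup>2"]] nz
      by (simp add: W123 mult_ac)
    \<comment> \<open>Substituting \<open>h * ux = Wx $ 2 - u * Wx $ 1\<close> removes the velocity
      derivative and flips the sign of the \<open>u\<^sup>2\<close> term.\<close>
    moreover have "(Wx $ 1 * u\<^sup>2 + 2 * ux * u * h) + 2 * Wx $ 1 * h / (2 * Fr\<^sup>2) =
        (h / Fr\<^sup>2 - u\<^sup>2) * Wx $ 1 + 2 * u * Wx $ 2"
      using nz by (simp add: ux_def field_simps power2_eq_square)
    ultimately show "((\<lambda>y. W t y $ 1 * (W t y $ 2 / W t y $ 1)\<^sup>2 + (W t y $ 1)\<^sup>2 / (2 * Fr\<^sup>2))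
        has_real_derivative (h / Fr\<^sup>2 - u\<^sup>2) * Wx $ 1 + 2 * u * Wx $ 2) (at x)"
      by simp
  qed
  have 3: "deriv (\<lambda>y. db * W t y $ 3) x = db * Wx $ 3"
    by (rule DERIV_imp_deriv) (auto intro!: derivative_eq_intros dx)
  have 4: "deriv (\<lambda>y. bl_flux H (W t y $ 2 / W t y $ 1) (W t y $ 3)) x =
      coeff_a H u m * ux + coeff_b H u m * Wx $ 3"
    using bl_flux_chain[of H "\<lambda>y. W t y $ 2 / W t y $ 1" x "\<lambda>y. W t y $ 3", OF _ u dx] diff nz
    by (intro DERIV_imp_deriv) (simp add: W123)
  have "ibl_system H Fr db W t x \<longleftrightarrow>
      Wt $ 1 + (Wx $ 2 - db * Wx $ 3) = 0 \<and>
      Wt $ 2 + ((h / Fr\<^sup>2 - u\<^sup>2) * Wx $ 1 + 2 * u * Wx $ 2) - u * (db * Wx $ 3) = 0 \<and>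
      Wt $ 3 + (coeff_a H u m * ux + coeff_b H u m * Wx $ 3) - u * Wx $ 3 = 0"
    unfolding ibl_system_def Let_def 1 2 3 4 dt[THEN DERIV_imp_deriv] dx[THEN DERIV_imp_deriv]
    using nz by (simp add: W123)
  also have "\<dots> \<longleftrightarrow> Wt + ibl_matrix H Fr db h u m *v Wx = 0"
  proof -
    have "coeff_a H u m * ux = - coeff_a H u m * u / h * Wx $ 1 + coeff_a H u m / h * Wx $ 2"
      using nz by (simp add: ux_def field_simps)
    moreover have "(ibl_matrix H Fr db h u m *v Wx) $ 1 = Wx $ 2 - db * Wx $ 3"
      "(ibl_matrix H Fr db h u m *v Wx) $ 2 =
        (h / Fr\<^sup>2 - u\<^sup>2) * Wx $ 1 + 2 * u * Wx $ 2 - db * u * Wx $ 3"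
      "(ibl_matrix H Fr db h u m *v Wx) $ 3 =
        - coeff_a H u m * u / h * Wx $ 1 + coeff_a H u m / h * Wx $ 2 + (coeff_b H u m * Wx $ 3 - u * Wx $ 3)"
      by (simp_all add: matrix_vector_mult_def sum_3 ibl_matrix_def left_diff_distrib)
    ultimately show ?thesis
      unfolding vec_eq_iff forall_3 vector_add_component zero_index
      by (simp only: add_diff_eq[symmetric] mult_ac add.assoc)
  qed
  finally show "ibl_system H Fr db W t x \<longleftrightarrow>
      vector_derivative (\<lambda>s. W s x) (at t) +
      ibl_matrix H Fr db h u m *v vector_derivative (\<lambda>y. W t y) (at x) = 0"
    by (simp add: Wt_def Wx_def)
qed

section \<open>Characteristic polynomial and levels of \<open>P_SW\<close>\<close>

lemma charpoly_ibl_matrix: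
  assumes "Fr > 0" and "h > 0"
  shows "poly (charpoly (ibl_matrix H Fr db h u m)) l = db * coeff_a H u m / Fr\<^sup>2 - P_SW H Fr h u m l"
proof -
  \<comment> \<open>With \<open>c\<close> and \<open>\<alpha>\<close> all divisions disappear, so
    the determinant becomes a polynomial identity. \<open>P_SW\<close> enters with a minus sign
    because its leading coefficient is -1 while \<open>charpoly\<close> is monic.\<close>
  define c where "c = h / Fr\<^sup>2"
  define \<alpha> where "\<alpha> = coeff_a H u m / h"
  have \<alpha>: "- coeff_a H u m * u / h = - \<alpha> * u" "db * coeff_a H u m / Fr\<^sup>2 = db * \<alpha> * c"
    using assms by (simp_all add: \<alpha>_def c_def)
  show ?thesis
    unfolding poly_charpoly det_3 ibl_matrix_def P_SW_def \<alpha> \<alpha>_def[symmetric] c_def[symmetric]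
    by (simp add: mat_def) (simp add: algebra_simps power2_eq_square)
qed

text \<open>The sign of \<open>f - k\<close> alternates along a far left point, \<open>p\<close>,
  \<open>q\<close> and a far right point; the intermediate value theorem gives a root in each of the
  three intervals.\<close>

lemma three_crossings:
  fixes f :: "real \<Rightarrow> real"
  assumes cont: "continuous_on UNIV f"
    and lim: "filterlim f at_top at_bot" "filterlim f at_bot at_top"
    and "p < q" "f p < k" "k < f q"
  obtains r1 r2 r3 where "r1 < r2" "r2 < r3" "f r1 = k" "f r2 = k" "f r3 = k"
proof -
  have c: "continuous_on {x..y} f" for x y
    using cont continuous_on_subset by blast
  have "\<forall>\<^sub>F x in at_bot. k < f x \<and> x < p"
    using lim(1) by (intro eventually_conj) (auto simp: filterlim_at_top_dense eventually_gt_at_bot)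
  then obtain x where x: "k < f x" "x < p"
    using eventually_happens[of _ "at_bot :: real filter"] by force
  have "\<forall>\<^sub>F y in at_top. f y < k \<and> q < y"
    using lim(2) by (intro eventually_conj) (auto simp: filterlim_at_bot_dense eventually_gt_at_top)
  then obtain y where y: "f y < k" "q < y"
    using eventually_happens[of _ "at_top :: real filter"] by force
  obtain r1 where "x \<le> r1" "r1 \<le> p" "f r1 = k"
    using IVT2'[of f p k x] x c assms by force
  moreover obtain r2 where "p \<le> r2" "r2 \<le> q" "f r2 = k"
    using IVT'[of f p k q] c assms by force
  moreover obtain r3 where "q \<le> r3" "r3 \<le> y" "f r3 = k"
    using IVT2'[of f y k q] y c assms by force
  \<comment> \<open>The level is not attained at \<open>p\<close> or \<open>q\<close>, so roots of
    adjacent intervals cannot coincide at an endpoint.\<close>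
  moreover have "r1 \<noteq> p" "r2 \<noteq> p" "r2 \<noteq> q" "r3 \<noteq> q"
    using calculation assms by auto
  ultimately show ?thesis
    using that[of r1 r2 r3] by linarith
qed

lemma filterlim_P_SW:
  "filterlim (P_SW H Fr h u m) at_top at_bot" "filterlim (P_SW H Fr h u m) at_bot at_top"
proof -
  \<comment> \<open>The coefficients are generalized to plain constants, so that only the leading
    term \<open>- l^3\<close> matters.\<close>
  have "filterlim (\<lambda>l. (\<beta> - l) * ((u - l)\<^sup>2 - c)) at_top at_bot"
    "filterlim (\<lambda>l. (\<beta> - l) * ((u - l)\<^sup>2 - c)) at_bot at_top" for \<beta> c :: real
    by real_asymp+
  then show "filterlim (P_SW H Fr h u m) at_top at_bot" "filterlim (P_SW H Fr h u m) at_bot at_top"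
    unfolding P_SW_def by blast+
qed

text \<open>The degree bounds the number of solutions by three, and the crossings supply
  three.\<close>

lemma card_P_SW_level:
  assumes "p < q" "P_SW H Fr h u m p < k" "k < P_SW H Fr h u m q"
  shows "card {l. P_SW H Fr h u m l = k} = 3"
proof (rule antisym)
  define \<beta> where "\<beta> = coeff_b H u m - u"
  define c where "c = h / Fr\<^sup>2"
  \<comment> \<open>The expansion of \<open>P_SW H Fr h u m l - k\<close> in powers of
    \<open>l\<close>, constant term first.\<close>
  define R where "R = [:\<beta> * (u\<^sup>2 - c) - k, - (u\<^sup>2 - c) - 2 * u * \<beta>, \<beta> + 2 * u, - 1:]"
  have R: "{l. P_SW H Fr h u m l = k} = {l. poly R l = 0}"
    unfolding P_SW_def R_def \<beta>_def[symmetric] c_def[symmetric] by (auto simp: algebra_simps power2_eq_square)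
  have "R \<noteq> 0" and "degree R = 3"
    by (simp_all add: R_def)
  then show "card {l. P_SW H Fr h u m l = k} \<le> 3"
    unfolding R using card_poly_roots_bound by metis
  have "continuous_on UNIV (P_SW H Fr h u m)"
    unfolding P_SW_def by (intro continuous_intros)
  then obtain r1 r2 r3 where r: "r1 < r2" "r2 < r3"
    "P_SW H Fr h u m r1 = k" "P_SW H Fr h u m r2 = k" "P_SW H Fr h u m r3 = k"
    using three_crossings[OF _ filterlim_P_SW assms] by metis
  have "finite {l. P_SW H Fr h u m l = k}"
    unfolding R using \<open>R \<noteq> 0\<close> by (rule poly_roots_finite)
  then have "card {r1, r2, r3} \<le> card {l. P_SW H Fr h u m l = k}"
    by (rule card_mono) (auto simp: r)
  then show "3 \<le> card {l. P_SW H Fr h u m l = k}"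
    using r by simp
qed

text \<open>The common criterion behind both claims: any pair \<open>p < q\<close> straddling the
  level will do, and three distinct eigenvalues of a 3 by 3 matrix make it diagonalizable.\<close>

lemma hyperbolic_ibl_system:
  assumes "Fr > 0" and "h > 0"
    and "(\<lambda>(v, n). bl_flux H v n) differentiable (at (u, m))"
    and "p < q" "P_SW H Fr h u m p < db * coeff_a H u m / Fr\<^sup>2"
      "db * coeff_a H u m / Fr\<^sup>2 < P_SW H Fr h u m q"
  shows "three_real_roots_at (ibl_system H Fr db) (vector [h, h * u, m]) \<and>
    hyperbolic_at (ibl_system H Fr db) (vector [h, h * u, m])"
proof -
  have "card {l. poly (charpoly (ibl_matrix H Fr db h u m)) l = 0} = 3"
    using card_P_SW_level[OF assms(4-6)]
    unfolding charpoly_ibl_matrix[OF assms(1,2)] right_minus_eq by (simp only: eq_commute[of "db * _ / _"])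
  then show ?thesis
    using quasilinear_matrix_ibl_system[OF assms(1-3)]
      diagonalizable_if_distinct_eigenvalues[of "ibl_matrix H Fr db h u m"]
    unfolding three_real_roots_at_def hyperbolic_at_def by auto
qed

section \<open>Critical points and sign changes of \<open>P_SW\<close>\<close>

lemma P_SW_critical_points:
  assumes "Fr > 0" and "h > 0"
  obtains lm lp where "lm < lp" "{l. deriv (P_SW H Fr h u m) l = 0} = {lm, lp}"
proof -
  \<comment> \<open>In the shifted variable \<open>y = l - u\<close> the cubic is
    \<open>(d - y) * (y\<^sup>2 - c)\<close>, with derivative
    \<open>- 3 * y\<^sup>2 + 2 * d * y + c\<close>. Its roots are \<open>(d - s) / 3\<close> and
    \<open>(d + s) / 3\<close>, distinct since \<open>c > 0\<close>.\<close>
  define d where "d = coeff_b H u m - u - u"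
  define c where "c = h / Fr\<^sup>2"
  define s where "s = sqrt (d\<^sup>2 + 3 * c)"
  have "c > 0" using assms by (simp add: c_def)
  then have s: "s > 0" "s\<^sup>2 = d\<^sup>2 + 3 * c"
    by (simp_all add: s_def add_nonneg_pos)
  define lm where "lm = u + (d - s) / 3"
  define lp where "lp = u + (d + s) / 3"
  have "deriv (P_SW H Fr h u m) l = - 3 * ((l - lm) * (l - lp))" for l
  proof -
    have "deriv (P_SW H Fr h u m) l = - ((u - l)\<^sup>2 - c) - 2 * (u - l) * (d + u - l)"
    proof (rule DERIV_imp_deriv)
      have "P_SW H Fr h u m = (\<lambda>l. (d + u - l) * ((u - l)\<^sup>2 - c))"
        by (simp add: fun_eq_iff P_SW_def d_def c_def)
      then show "(P_SW H Fr h u m has_real_derivative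
          - ((u - l)\<^sup>2 - c) - 2 * (u - l) * (d + u - l)) (at l)"
        by (auto intro!: derivative_eq_intros simp: algebra_simps)
    qed
    also have "\<dots> = - 3 * (l - u)\<^sup>2 + 2 * d * (l - u) + (s\<^sup>2 - d\<^sup>2) / 3"
      unfolding s(2) by (simp add: algebra_simps power2_eq_square)
    also have "\<dots> = - 3 * ((l - lm) * (l - lp))"
      by (simp add: lm_def lp_def field_simps power2_eq_square)
    finally show ?thesis .
  qed
  then have "{l. deriv (P_SW H Fr h u m) l = 0} = {lm, lp}"
    by auto
  moreover have "lm < lp"
    using s(1) by (simp add: lm_def lp_def)
  ultimately show ?thesis using that by blast
qed

text \<open>With three distinct roots and leading coefficient -1, the cubic is negative in the first
  gap between roots and positive in the second.\<close>

lemma P_SW_sign_change: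
  assumes "Fr > 0" and "h > 0"
    and "coeff_b H u m - u \<noteq> u + sqrt h / Fr" "coeff_b H u m - u \<noteq> u - sqrt h / Fr"
  obtains p q where "p < q" "P_SW H Fr h u m p < 0" "0 < P_SW H Fr h u m q"
proof -
  define \<beta> where "\<beta> = coeff_b H u m - u"
  define s where "s = sqrt h / Fr"
  have "s > 0" using assms by (simp add: s_def)
  have P: "P_SW H Fr h u m l = (\<beta> - l) * ((u - s - l) * (u + s - l))" for l
  proof -
    have "h / Fr\<^sup>2 = s\<^sup>2" using assms by (simp add: s_def power_divide)
    then show ?thesis
      by (simp add: P_SW_def \<beta>_def power2_eq_square algebra_simps)
  qed
  \<comment> \<open>The cases are the possible orders of the roots. The witnesses \<open>p\<close>
    and \<open>q\<close> are the midpoints of the two gaps; \<open>u\<close> is the midpoint of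
    \<open>u - s\<close> and \<open>u + s\<close>.\<close>
  consider "\<beta> < u - s" | "u - s < \<beta>" "\<beta> < u + s" | "u + s < \<beta>"
    using assms(3,4) unfolding \<beta>_def s_def by linarith
  then show ?thesis
  proof cases
    case 1
    show ?thesis
      by (rule that[of "(\<beta> + (u - s)) / 2" u]; use 1 \<open>s > 0\<close> in
          \<open>simp add: P mult_less_0_iff zero_less_mult_iff\<close>)
  next
    case 2
    show ?thesis
      by (rule that[of "(u - s + \<beta>) / 2" "(\<beta> + (u + s)) / 2"]; use 2 \<open>s > 0\<close> in
          \<open>simp add: P mult_less_0_iff zero_less_mult_iff\<close>)
  next
    case 3
    show ?thesis
      by (rule that[of u "(u + s + \<beta>) / 2"]; use 3 \<open>s > 0\<close> in
          \<open>simp add: P mult_less_0_iff zero_less_mult_iff\<close>)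
  qed
qed

text \<open>The two inequalities exclude a double root of \<open>P_SW\<close>: there, a slight shift
  of the level to the wrong side would leave a single real root. The threshold \<open>db0\<close>
  may depend on the state.\<close>

theorem mainTheorem4:
  fixes H :: "real \<Rightarrow> real \<Rightarrow> real" and Fr h u m :: real
  assumes "Fr > 0" and "h > 0"
    and "(\<lambda>(v, n). bl_flux H v n) differentiable (at (u, m))"
  shows
    "(coeff_b H u m - u \<noteq> u + sqrt h / Fr \<and> coeff_b H u m - u \<noteq> u - sqrt h / Fr \<longrightarrow>
       (\<exists>db0>0. \<forall>db. 0 < db \<and> db < db0 \<longrightarrow>
          three_real_roots_at (ibl_system H Fr db) (vector [h, h * u, m]) \<and>
          hyperbolic_at (ibl_system H Fr db) (vector [h, h * u, m]))) \<and>
     (\<exists>lm lp. lm < lp \<and> {l. deriv (P_SW H Fr h u m) l = 0} = {lm, lp} \<and>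
       (\<forall>db>0.
          P_SW H Fr h u m lm < db * coeff_a H u m / Fr\<^sup>2 \<and>
          db * coeff_a H u m / Fr\<^sup>2 < P_SW H Fr h u m lp \<longrightarrow>
          three_real_roots_at (ibl_system H Fr db) (vector [h, h * u, m]) \<and>
          hyperbolic_at (ibl_system H Fr db) (vector [h, h * u, m])))"
proof (intro conjI impI)
  assume "coeff_b H u m - u \<noteq> u + sqrt h / Fr \<and> coeff_b H u m - u \<noteq> u - sqrt h / Fr"
  then obtain p q where pq: "p < q" "P_SW H Fr h u m p < 0" "0 < P_SW H Fr h u m q"
    using P_SW_sign_change[OF assms(1,2)] by blast
  \<comment> \<open>The level tends to 0 whatever the sign of \<open>coeff_a H u m\<close>, so it
    eventually lies strictly between the negative value at \<open>p\<close> and the positive value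
    at \<open>q\<close>.\<close>
  have "((\<lambda>db. db * coeff_a H u m / Fr\<^sup>2) \<longlongrightarrow> 0 * coeff_a H u m / Fr\<^sup>2) (at_right 0)"
    using assms(1) by (intro tendsto_intros) auto
  then have "\<forall>\<^sub>F db in at_right 0. P_SW H Fr h u m p < db * coeff_a H u m / Fr\<^sup>2 \<and>
      db * coeff_a H u m / Fr\<^sup>2 < P_SW H Fr h u m q"
    using pq by (intro eventually_conj) (auto dest: order_tendstoD)
  then show "\<exists>db0>0. \<forall>db. 0 < db \<and> db < db0 \<longrightarrow>
      three_real_roots_at (ibl_system H Fr db) (vector [h, h * u, m]) \<and>
      hyperbolic_at (ibl_system H Fr db) (vector [h, h * u, m])"
    using hyperbolic_ibl_system[OF assms pq(1)] unfolding eventually_at_right_field by metis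
next
  obtain lm lp where "lm < lp" "{l. deriv (P_SW H Fr h u m) l = 0} = {lm, lp}"
    using P_SW_critical_points[OF assms(1,2)] by blast
  then show "\<exists>lm lp. lm < lp \<and> {l. deriv (P_SW H Fr h u m) l = 0} = {lm, lp} \<and>
       (\<forall>db>0.
          P_SW H Fr h u m lm < db * coeff_a H u m / Fr\<^sup>2 \<and>
          db * coeff_a H u m / Fr\<^sup>2 < P_SW H Fr h u m lp \<longrightarrow>
          three_real_roots_at (ibl_system H Fr db) (vector [h, h * u, m]) \<and>
          hyperbolic_at (ibl_system H Fr db) (vector [h, h * u, m]))"
    using hyperbolic_ibl_system[OF assms] by blast
qed

end
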